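(* Suppose that for each $1\le j\le p$ the term $n^{-1}\boldsymbol{\psi}_j^\top\boldsymbol{\epsilon}$ follows a Gaussian distribution $N(0,\sigma^2/n)$. Let $\hat{\boldsymbol{\mu}}_{\cdot\mathrm{T}}$ denote either the soft-thresholding estimator $\hat{\boldsymbol{\mu}}_{\mathrm{ST}}$ or the hard-thresholding estimator $\hat{\boldsymbol{\mu}}_{\mathrm{HT}}$. If $p\to\infty$ as $n\to\infty$, then $$\max_{\boldsymbol{\mu}\in\mathbb{R}^n}\frac{R_n(\hat{\boldsymbol{\mu}}_{\cdot\mathrm{T}},\boldsymbol{\mu})}{n^{-1}+R_n(\hat{\boldsymbol{\mu}}_{\mathbf{w}^*|\mathcal{M}_{AS}},\boldsymbol{\mu})}\le[1+o(1)]\,2\log p ,$$ where the maximum is over all $\boldsymbol{\mu}\in\mathbb{R}^n$ of the form $\boldsymbol{\mu}=\sum_{j=1}^p\theta_j\boldsymbol{\psi}_j$ with $\theta_1,\dots,\theta_p\in\mathbb{R}$.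
   Context: Model: $\mathbf{y}=\boldsymbol{\mu}+\boldsymbol{\epsilon}$ in $\mathbb{R}^n$, where $\boldsymbol{\epsilon}=(\epsilon_1,\dots,\epsilon_n)^\top$ has independent components with mean zero and variance $\sigma^2$ ($\sigma^2>0$ does not depend on $n$ and is known). $\|\cdot\|$ is the Euclidean norm. For an estimator $\hat{\boldsymbol{\mu}}$ the risk is $R_n(\hat{\boldsymbol{\mu}},\boldsymbol{\mu})=n^{-1}\mathbb{E}\|\hat{\boldsymbol{\mu}}-\boldsymbol{\mu}\|^2$. "$\max$" is understood as supremum; $o(1)$ denotes a quantity tending to $0$ as $n\to\infty$. Complete orthogonal basis: $\boldsymbol{\psi}_1,\dots,\boldsymbol{\psi}_p\in\mathbb{R}^n$ ($1\le p\le n$) are given with $n^{-1}\|\boldsymbol{\psi}_j\|^2=1$ and $\boldsymbol{\psi}_j^\top\boldsymbol{\psi}_{j'}=0$ for $j\ne j'$, and the true mean vector has the representation $\boldsymbol{\mu}=\sum_{j=1}^p\theta_j\boldsymbol{\psi}_j$. All-subset model averaging: for $\mathcal{I}\subseteq\{1,\dots,p\}$ let $\hat{\boldsymbol{\mu}}_{\mathcal{I}}$ be the orthogonal projection of $\mathbf{y}$ onto $\operatorname{span}\{\boldsymbol{\psi}_j:j\in\mathcal{I}\}$ (so $\hat{\boldsymbol{\mu}}_{\emptyset}=\boldsymbol 0$). Let $\mathcal{M}_{AS}=\{\mathcal{I}:\mathcal{I}\subseteq\{1,\dots,p\}\}$, and for weights $\mathbf{w}=(w_{\mathcal{I}})_{\mathcal{I}}$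 with $w_{\mathcal{I}}\in[0,1]$ and $\sum_{\mathcal{I}}w_{\mathcal{I}}=1$ let $\hat{\boldsymbol{\mu}}_{\mathbf{w}|\mathcal{M}_{AS}}=\sum_{\mathcal{I}}w_{\mathcal{I}}\hat{\boldsymbol{\mu}}_{\mathcal{I}}$. The optimal all-subset model averaging risk is $R_n(\hat{\boldsymbol{\mu}}_{\mathbf{w}^*|\mathcal{M}_{AS}},\boldsymbol{\mu})=\min_{\mathbf{w}}R_n(\hat{\boldsymbol{\mu}}_{\mathbf{w}|\mathcal{M}_{AS}},\boldsymbol{\mu})$, the minimum being over such deterministic weights. Thresholding estimators: with $\tilde{\theta}_j=n^{-1}\boldsymbol{\psi}_j^\top\mathbf{y}$, $\lambda_2=\sqrt{(2\log p)/n}$, and $a_+=\max(a,0)$, $$\hat{\boldsymbol{\mu}}_{\mathrm{ST}}=\sum_{j=1}^p\operatorname{sgn}(\tilde{\theta}_j)\bigl(|\tilde{\theta}_j|-\lambda_2\sigma\bigr)_+\boldsymbol{\psi}_j,\qquad \hat{\boldsymbol{\mu}}_{\mathrm{HT}}=\sum_{j=1}^p 1_{\{|\tilde{\theta}_j|>\lambda_2\sigma\}}\tilde{\theta}_j\boldsymbol{\psi}_j .$$ *)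

theory Defs
  imports "HOL-Probability.Probability"
begin

text \<open>
  Since the dimension \<open>n\<close> varies, a vector of \<open>\<real>\<^sup>n\<close> is represented by a function
  \<open>nat \<Rightarrow> real\<close> of which only the coordinates in \<open>{1..n}\<close> enter inner products and norms
  (the Euclidean norm is \<open>L2_set x {1..n}\<close>). A system \<open>\<psi>\<^sub>1, \<dots>, \<psi>\<^sub>p\<close> is a function
  \<open>\<psi>\<close> such that \<open>\<psi> j i\<close> is the \<open>i\<close>-th coordinate of \<open>\<psi>\<^sub>j\<close>.
\<close>

definition dot :: "nat \<Rightarrow> (nat \<Rightarrow> real) \<Rightarrow> (nat \<Rightarrow> real) \<Rightarrow> real" where
  "dot n x y = (\<Sum>i\<in>{1..n}. x i * y i)"

definition lin_comb :: "nat set \<Rightarrow> (nat \<Rightarrow> real) \<Rightarrow> (nat \<Rightarrow> nat \<Rightarrow> real) \<Rightarrow> nat \<Rightarrow> real" where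
  "lin_comb I c \<psi> = (\<lambda>i. \<Sum>j\<in>I. c j * \<psi> j i)"

definition lin_span :: "nat set \<Rightarrow> (nat \<Rightarrow> nat \<Rightarrow> real) \<Rightarrow> (nat \<Rightarrow> real) set" where
  "lin_span I \<psi> = range (\<lambda>c. lin_comb I c \<psi>)"

text \<open>
  The coordinates outside \<open>{1..n}\<close> do not spoil uniqueness: if the \<open>\<psi> j\<close> with \<open>j \<in> I\<close> are
  linearly independent on \<open>{1..n}\<close>, the conditions determine the coefficients of \<open>v\<close>.
\<close>

definition orth_proj ::
    "nat \<Rightarrow> (nat \<Rightarrow> nat \<Rightarrow> real) \<Rightarrow> nat set \<Rightarrow> (nat \<Rightarrow> real) \<Rightarrow> nat \<Rightarrow> real" where
  "orth_proj n \<psi> I y =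
     (THE v. v \<in> lin_span I \<psi> \<and> (\<forall>u\<in>lin_span I \<psi>. dot n (\<lambda>i. y i - v i) u = 0))"

text \<open>
  An estimator is a function of the data vector. The squared error is integrable for all
  estimators below whenever the noise is square integrable, so the Bochner integral is the
  genuine expectation.
\<close>

definition risk ::
    "nat \<Rightarrow> 'a measure \<Rightarrow> (nat \<Rightarrow> 'a \<Rightarrow> real) \<Rightarrow> ((nat \<Rightarrow> real) \<Rightarrow> nat \<Rightarrow> real) \<Rightarrow> (nat \<Rightarrow> real) \<Rightarrow> real"
  where
  "risk n M \<epsilon> est \<mu> =
     (1 / real n) *
     (\<integral>\<omega>. (L2_set (\<lambda>i. est (\<lambda>k. \<mu> k + \<epsilon> k \<omega>) i - \<mu> i) {1..n})\<^sup>2 \<partial>M)"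

definition weights :: "nat \<Rightarrow> (nat set \<Rightarrow> real) set" where
  "weights p =
     {w. (\<forall>I\<in>Pow {1..p}. 0 \<le> w I \<and> w I \<le> 1) \<and> (\<Sum>I\<in>Pow {1..p}. w I) = 1}"

definition ma_estimator ::
    "nat \<Rightarrow> nat \<Rightarrow> (nat \<Rightarrow> nat \<Rightarrow> real) \<Rightarrow> (nat set \<Rightarrow> real) \<Rightarrow> (nat \<Rightarrow> real) \<Rightarrow> nat \<Rightarrow> real" where
  "ma_estimator n p \<psi> w y = (\<lambda>i. \<Sum>I\<in>Pow {1..p}. w I * orth_proj n \<psi> I y i)"

text \<open>
  The infimum is a minimum: the risk is a continuous (quadratic) function of the finitely many
  relevant weights, which range over a simplex.
\<close>

definition optimal_ma_risk ::
    "nat \<Rightarrow> nat \<Rightarrow> (nat \<Rightarrow> nat \<Rightarrow> real) \<Rightarrow> 'a measure \<Rightarrow> (nat \<Rightarrow> 'a \<Rightarrow> real) \<Rightarrow> (nat \<Rightarrow> real) \<Rightarrow> real"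
  where
  "optimal_ma_risk n p \<psi> M \<epsilon> \<mu> = (INF w\<in>weights p. risk n M \<epsilon> (ma_estimator n p \<psi> w) \<mu>)"

definition coef_est :: "nat \<Rightarrow> (nat \<Rightarrow> nat \<Rightarrow> real) \<Rightarrow> (nat \<Rightarrow> real) \<Rightarrow> nat \<Rightarrow> real" where
  "coef_est n \<psi> y j = dot n (\<psi> j) y / real n"

definition threshold :: "nat \<Rightarrow> nat \<Rightarrow> real" where
  "threshold n p = sqrt (2 * ln (real p) / real n)"

definition soft_threshold ::
    "real \<Rightarrow> nat \<Rightarrow> nat \<Rightarrow> (nat \<Rightarrow> nat \<Rightarrow> real) \<Rightarrow> (nat \<Rightarrow> real) \<Rightarrow> nat \<Rightarrow> real" where
  "soft_threshold \<sigma> n p \<psi> y =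
     lin_comb {1..p}
       (\<lambda>j. sgn (coef_est n \<psi> y j) * max (\<bar>coef_est n \<psi> y j\<bar> - threshold n p * \<sigma>) 0) \<psi>"

definition hard_threshold ::
    "real \<Rightarrow> nat \<Rightarrow> nat \<Rightarrow> (nat \<Rightarrow> nat \<Rightarrow> real) \<Rightarrow> (nat \<Rightarrow> real) \<Rightarrow> nat \<Rightarrow> real" where
  "hard_threshold \<sigma> n p \<psi> y =
     lin_comb {1..p}
       (\<lambda>j. if \<bar>coef_est n \<psi> y j\<bar> > threshold n p * \<sigma> then coef_est n \<psi> y j else 0) \<psi>"

end

theory Submission
  imports Defs
begin

text \<open>
  In the coordinates \<open>\<theta>\<close> of the orthogonal basis everything decouples. With \<open>s = \<sigma> / sqrt n\<close> one
  observes \<open>\<theta> j + s * Z j\<close>, where each \<open>Z j\<close> is standard normal, and by Parseval the risk is the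
  sum of the coordinatewise mean squared errors. Put \<open>t j = \<theta> j / s\<close> and \<open>\<lambda> = sqrt (2 ln p)\<close>.

  Averaging over subsets multiplies the \<open>j\<close>-th observation by a deterministic factor (the total
  weight of the subsets containing \<open>j\<close>), and the best linear factor has risk
  \<open>s\<^sup>2 t\<^sup>2 / (t\<^sup>2 + 1)\<close>. So the optimal averaging risk is at least \<open>s\<^sup>2 * (\<Sum>j. (t j)\<^sup>2 / ((t j)\<^sup>2 + 1))\<close>
  (\<open>optimal_ma_risk_ge\<close>).

  For thresholding, the mean squared error of one coordinate in units of \<open>s\<^sup>2\<close> is at most
  \<open>e + K * t\<^sup>2 / (t\<^sup>2 + 1)\<close> with \<open>e = O(\<lambda> / p)\<close> and \<open>K = \<lambda>\<^sup>2 * (1 + o(1))\<close>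
  (\<open>threshold_loss_unit_noise\<close>). Soft and hard thresholding are treated together, since only two
  pointwise estimates are used: the loss is at most \<open>t\<^sup>2\<close>, plus \<open>Z\<^sup>2\<close> if the observation passes
  the threshold, and its square root is at most \<open>\<lambda> + \<bar>Z\<bar>\<close>. The leading constant
  \<open>\<lambda>\<^sup>2 = 2 ln p\<close> comes from \<open>\<bar>t\<bar>\<close> near and above \<open>\<lambda>\<close>. For \<open>\<bar>t\<bar> \<le> 1 / \<lambda>\<close> the Gaussian tail beyond
  \<open>\<lambda> - 1 / \<lambda>\<close> is what gives \<open>e\<close>: moving the cutoff by \<open>1 / \<lambda>\<close> costs only a factor \<open>exp 1\<close>.

  Summed over the \<open>p\<close> coordinates the terms \<open>e\<close> contribute \<open>O(s\<^sup>2 * \<lambda>)\<close>. As \<open>s\<^sup>2 = \<sigma>\<^sup>2 / n\<close>, this is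
  \<open>O(\<lambda>) = o(\<lambda>\<^sup>2)\<close> times the summand \<open>1 / n\<close> of the denominator.
\<close>

section \<open>Truncated second moments of the standard normal distribution\<close>

text \<open>
  The derivative \<open>2 * (x\<^sup>2 - 1) * std_normal_density x\<close> of \<open>- 2 * x * std_normal_density x\<close>
  dominates \<open>x\<^sup>2 * std_normal_density x\<close> as soon as \<open>x\<^sup>2 \<ge> 2\<close>. The order \<open>u * std_normal_density u\<close>
  is sharp, and a bound with \<open>u\<^sup>2\<close> in place of \<open>u\<close> would be too weak below.
\<close>

lemma (in prob_space) std_normal_upper_tail_second_moment:
  fixes Z :: "'a \<Rightarrow> real"
  assumes Z: "distributed M lborel Z std_normal_density" and u: "u\<^sup>2 \<ge> 2" "u \<ge> 0"
  shows "expectation (\<lambda>\<omega>. (Z \<omega>)\<^sup>2 * indicator {u..} (Z \<omega>)) \<le> 2 * u * std_normal_density u"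
proof -
  define c where "c = 1 / sqrt (2 * pi)"
  have c: "c \<ge> 0" by (simp add: c_def)
  have phi: "std_normal_density x = c * exp (- x\<^sup>2 / 2)" for x
    by (simp add: std_normal_density_def c_def)
  have two_le: "x\<^sup>2 \<ge> 2" if "x \<ge> u" for x
    using u power_mono[OF that, of 2] by linarith
  have "(\<integral>\<^sup>+\<omega>. ennreal ((Z \<omega>)\<^sup>2 * indicator {u..} (Z \<omega>)) \<partial>M)
      = (\<integral>\<^sup>+x. ennreal (std_normal_density x) * ennreal (x\<^sup>2 * indicator {u..} x) \<partial>lborel)"
    by (rule distributed_nn_integral[OF Z, symmetric]) simp
  also have "\<dots> \<le> (\<integral>\<^sup>+x. ennreal (2 * c * (x\<^sup>2 - 1) * exp (- x\<^sup>2 / 2)) * indicator {u..} x \<partial>lborel)"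
  proof (rule nn_integral_mono)
    fix x :: real
    show "ennreal (std_normal_density x) * ennreal (x\<^sup>2 * indicator {u..} x)
        \<le> ennreal (2 * c * (x\<^sup>2 - 1) * exp (- x\<^sup>2 / 2)) * indicator {u..} x"
    proof (cases "x \<ge> u")
      case True
      have "(c * exp (- x\<^sup>2 / 2)) * x\<^sup>2 \<le> (c * exp (- x\<^sup>2 / 2)) * (2 * (x\<^sup>2 - 1))"
        using two_le[OF True] c by (intro mult_left_mono) auto
      then show ?thesis
        using True c by (simp add: phi ennreal_mult'[symmetric] ac_simps ennreal_leI)
    qed simp
  qed
  also have "\<dots> = ennreal (0 - (- (2 * c * u * exp (- u\<^sup>2 / 2))))"
  proof (rule nn_integral_FTC_atLeast)
    show "((\<lambda>x. - (2 * c * x * exp (- x\<^sup>2 / 2))) has_real_derivative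
        2 * c * (x\<^sup>2 - 1) * exp (- x\<^sup>2 / 2)) (at x)" for x
      by (auto intro!: derivative_eq_intros simp: power2_eq_square algebra_simps)
    show "0 \<le> 2 * c * (x\<^sup>2 - 1) * exp (- x\<^sup>2 / 2)" if "u \<le> x" for x
      using two_le[OF that] c by simp
    show "((\<lambda>x. - (2 * c * x * exp (- x\<^sup>2 / 2))) \<longlongrightarrow> 0) at_top"
      by real_asymp
  qed simp
  also have "\<dots> = ennreal (2 * u * std_normal_density u)"
    by (simp add: phi ac_simps)
  finally have le: "(\<integral>\<^sup>+\<omega>. ennreal ((Z \<omega>)\<^sup>2 * indicator {u..} (Z \<omega>)) \<partial>M)
      \<le> ennreal (2 * u * std_normal_density u)" .
  have "expectation (\<lambda>\<omega>. (Z \<omega>)\<^sup>2 * indicator {u..} (Z \<omega>))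
      = enn2real (\<integral>\<^sup>+\<omega>. ennreal ((Z \<omega>)\<^sup>2 * indicator {u..} (Z \<omega>)) \<partial>M)"
    using distributed_measurable[OF Z] by (intro integral_eq_nn_integral) auto
  also have "\<dots> \<le> 2 * u * std_normal_density u"
    using enn2real_mono[OF le] u by simp
  finally show ?thesis .
qed

lemma (in prob_space) std_normal_moments:
  fixes Z :: "'a \<Rightarrow> real"
  assumes Z: "distributed M lborel Z std_normal_density"
  shows "integrable M Z" "integrable M (\<lambda>\<omega>. (Z \<omega>)\<^sup>2)" "expectation (\<lambda>\<omega>. (Z \<omega>)\<^sup>2) = 1"
    "expectation Z = 0"
proof -
  show "integrable M Z"
    using distributed_integrable[OF Z, of "\<lambda>x. x"] integrable_std_normal_moment[of 1] by simp
  show "integrable M (\<lambda>\<omega>. (Z \<omega>)\<^sup>2)"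
    using distributed_integrable[OF Z, of "\<lambda>x. x\<^sup>2"] integrable_std_normal_moment[of 2] by simp
  show "expectation Z = 0"
    by (rule standard_normal_distributed_expectation[OF Z])
  then show "expectation (\<lambda>\<omega>. (Z \<omega>)\<^sup>2) = 1"
    using standard_normal_distributed_variance[OF Z] by simp
qed

lemma (in prob_space) std_normal_tail_second_moment:
  fixes Z :: "'a \<Rightarrow> real"
  assumes Z: "distributed M lborel Z std_normal_density" and u: "u\<^sup>2 \<ge> 2" "u \<ge> 0"
  shows "expectation (\<lambda>\<omega>. (Z \<omega>)\<^sup>2 * indicator {x. u \<le> \<bar>x\<bar>} (Z \<omega>)) \<le> 4 * u * std_normal_density u"
proof -
  have Z': "distributed M lborel (\<lambda>\<omega>. - Z \<omega>) std_normal_density"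
    using normal_density_affine[OF Z, of "-1" 0] by simp
  have [measurable]: "Z \<in> borel_measurable M" using distributed_measurable[OF Z] by simp
  note int = std_normal_moments(2)[OF Z]
  have i1: "integrable M (\<lambda>\<omega>. (Z \<omega>)\<^sup>2 * indicator {u..} (Z \<omega>))"
    by (rule Bochner_Integration.integrable_bound[OF int]) (auto split: split_indicator)
  have i2: "integrable M (\<lambda>\<omega>. (- Z \<omega>)\<^sup>2 * indicator {u..} (- Z \<omega>))"
    by (rule Bochner_Integration.integrable_bound[OF int]) (auto split: split_indicator)
  have "expectation (\<lambda>\<omega>. (Z \<omega>)\<^sup>2 * indicator {x. u \<le> \<bar>x\<bar>} (Z \<omega>))
      \<le> expectation (\<lambda>\<omega>. (Z \<omega>)\<^sup>2 * indicator {u..} (Z \<omega>) + (- Z \<omega>)\<^sup>2 * indicator {u..} (- Z \<omega>))"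
  proof (rule integral_mono)
    show "integrable M (\<lambda>\<omega>. (Z \<omega>)\<^sup>2 * indicator {x. u \<le> \<bar>x\<bar>} (Z \<omega>))"
      by (rule Bochner_Integration.integrable_bound[OF int]) (auto split: split_indicator)
    show "integrable M (\<lambda>\<omega>. (Z \<omega>)\<^sup>2 * indicator {u..} (Z \<omega>) + (- Z \<omega>)\<^sup>2 * indicator {u..} (- Z \<omega>))"
      by (rule Bochner_Integration.integrable_add[OF i1 i2])
  qed (auto split: split_indicator)
  also have "\<dots> = expectation (\<lambda>\<omega>. (Z \<omega>)\<^sup>2 * indicator {u..} (Z \<omega>))
      + expectation (\<lambda>\<omega>. (- Z \<omega>)\<^sup>2 * indicator {u..} (- Z \<omega>))"
    by (rule Bochner_Integration.integral_add[OF i1 i2])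
  also have "\<dots> \<le> 4 * u * std_normal_density u"
    using std_normal_upper_tail_second_moment[OF Z u] std_normal_upper_tail_second_moment[OF Z' u]
    by simp
  finally show ?thesis .
qed

section \<open>Thresholding one Gaussian observation\<close>

text \<open>
  The common features of soft and hard thresholding at level \<open>l\<close>. The first inequality is the
  sharper one for a small parameter \<open>\<theta>\<close>, the second one for a large parameter.
\<close>

definition threshold_rule :: "real \<Rightarrow> (real \<Rightarrow> real) \<Rightarrow> bool" where
  "threshold_rule l \<eta> \<longleftrightarrow> \<eta> \<in> borel_measurable borel \<and>
     (\<forall>\<theta> x. (\<eta> x - \<theta>)\<^sup>2 \<le> \<theta>\<^sup>2 + (x - \<theta>)\<^sup>2 * indicator {y. l < \<bar>y\<bar>} x \<and>
            \<bar>\<eta> x - \<theta>\<bar> \<le> l + \<bar>x - \<theta>\<bar>)"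

lemma threshold_rule_hard:
  assumes "l \<ge> 0"
  shows "threshold_rule l (\<lambda>x. if \<bar>x\<bar> > l then x else 0)"
  unfolding threshold_rule_def using assms by (auto split: split_indicator)

text \<open>
  If \<open>x > l\<close>, then the error \<open>x - l - \<theta>\<close> lies between \<open>- \<theta>\<close> and \<open>x - \<theta>\<close>, so that its square is
  at most the larger of \<open>\<theta>\<^sup>2\<close> and \<open>(x - \<theta>)\<^sup>2\<close>. The case \<open>x < - l\<close> follows by reflection.
\<close>

lemma threshold_rule_soft:
  assumes "l \<ge> 0"
  shows "threshold_rule l (\<lambda>x. sgn x * max (\<bar>x\<bar> - l) 0)"
proof -
  have sq: "(x - l - \<theta>)\<^sup>2 \<le> \<theta>\<^sup>2 + (x - \<theta>)\<^sup>2" if "x > l" for x \<theta> :: real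
  proof (cases "x - l - \<theta> \<ge> 0")
    case True
    then have "(x - l - \<theta>)\<^sup>2 \<le> (x - \<theta>)\<^sup>2" using assms by (intro power_mono) auto
    then show ?thesis by (smt (verit) zero_le_power2)
  next
    case False
    then have "(- (x - l - \<theta>))\<^sup>2 \<le> \<theta>\<^sup>2" using that by (intro power_mono) auto
    then show ?thesis by (smt (verit) power2_minus zero_le_power2)
  qed
  have eq: "sgn x * max (\<bar>x\<bar> - l) 0 = (if x > l then x - l else if - x > l then - (- x - l) else 0)" for x
    using assms by (auto simp: sgn_if max_def)
  have neg: "(- (- x - l) - \<theta>)\<^sup>2 \<le> \<theta>\<^sup>2 + (x - \<theta>)\<^sup>2" if "- x > l" for x \<theta> :: real
    using sq[OF that, of "- \<theta>"] by (simp add: power2_eq_square algebra_simps)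
  show ?thesis
    unfolding threshold_rule_def
  proof (intro conjI allI)
    fix \<theta> x
    show "(sgn x * max (\<bar>x\<bar> - l) 0 - \<theta>)\<^sup>2 \<le> \<theta>\<^sup>2 + (x - \<theta>)\<^sup>2 * indicator {y. l < \<bar>y\<bar>} x"
      unfolding eq using sq[of x \<theta>] neg[of x \<theta>] assms by (auto split: split_indicator)
    show "\<bar>sgn x * max (\<bar>x\<bar> - l) 0 - \<theta>\<bar> \<le> l + \<bar>x - \<theta>\<bar>"
      unfolding eq using assms by auto
  qed simp
qed

text \<open>
  The first factor bounds the risk for every parameter; the second one is the reciprocal of
  \<open>t\<^sup>2 / (t\<^sup>2 + 1)\<close> at \<open>t = l\<close>.
\<close>

definition risk_factor :: "real \<Rightarrow> real" where
  "risk_factor l = (l + 1)\<^sup>2 * (1 + 1 / l\<^sup>2)"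

text \<open>
  Three ranges of the parameter \<open>t\<close> need different estimates of the risk. If \<open>\<bar>t\<bar> \<le> 1 / l\<close>, the
  observation passes the threshold only if \<open>\<bar>Z\<bar> \<ge> l - 1 / l\<close>, and the risk is \<open>t\<^sup>2\<close> plus a Gaussian
  tail. If \<open>1 / l \<le> \<bar>t\<bar> \<le> l\<close>, the crude bound \<open>t\<^sup>2 + 1\<close> is good enough: its quotient by
  \<open>t\<^sup>2 / (t\<^sup>2 + 1)\<close> is \<open>t\<^sup>2 + 2 + 1 / t\<^sup>2\<close>, which is largest at both ends of the range. If
  \<open>\<bar>t\<bar> \<ge> l\<close>, the bound \<open>(l + 1)\<^sup>2\<close> is used.
\<close>

lemma (in prob_space) threshold_loss_unit_noise:
  fixes Z L :: "'a \<Rightarrow> real"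
  assumes Z: "distributed M lborel Z std_normal_density" and l: "l \<ge> 2"
    and L_meas[measurable]: "L \<in> borel_measurable M"
    and L_nonneg: "\<And>\<omega>. 0 \<le> L \<omega>"
    and L_kill: "\<And>\<omega>. L \<omega> \<le> t\<^sup>2 + (Z \<omega>)\<^sup>2 * indicator {y. l < \<bar>y\<bar>} (t + Z \<omega>)"
    and L_keep: "\<And>\<omega>. L \<omega> \<le> (l + \<bar>Z \<omega>\<bar>)\<^sup>2"
  shows "integrable M L"
    and "expectation L \<le> 4 * exp 1 * l * exp (- l\<^sup>2 / 2) + risk_factor l * (t\<^sup>2 / (t\<^sup>2 + 1))"
proof -
  have [measurable]: "Z \<in> borel_measurable M" using distributed_measurable[OF Z] by simp
  note int = std_normal_moments(2)[OF Z] and EZ = std_normal_moments(3)[OF Z]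
  have int': "integrable M (\<lambda>\<omega>. a + b * (Z \<omega>)\<^sup>2)" and
    E': "expectation (\<lambda>\<omega>. a + b * (Z \<omega>)\<^sup>2) = a + b" for a b :: real
    using int EZ by (auto simp: prob_space)
  have L_sq: "L \<omega> \<le> t\<^sup>2 + 1 * (Z \<omega>)\<^sup>2" for \<omega>
  proof -
    have "(Z \<omega>)\<^sup>2 * indicator {y. l < \<bar>y\<bar>} (t + Z \<omega>) \<le> (Z \<omega>)\<^sup>2"
      by (simp split: split_indicator)
    then show ?thesis using L_kill[of \<omega>] by linarith
  qed
  show iL: "integrable M L"
    by (rule Bochner_Integration.integrable_bound[OF int'[of "t\<^sup>2" 1]])
       (use L_nonneg L_sq in \<open>auto simp: abs_of_nonneg\<close>)
  have E_mid: "expectation L \<le> t\<^sup>2 + 1"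
    using integral_mono[OF iL int' L_sq] E'[of "t\<^sup>2" 1] by simp
  have E_large: "expectation L \<le> (l + 1)\<^sup>2"
  proof -
    \<comment> \<open>The cross term of the square is linearized by \<open>2 * \<bar>Z\<bar> \<le> 1 + Z\<^sup>2\<close>.\<close>
    have "L \<omega> \<le> (l\<^sup>2 + l) + (l + 1) * (Z \<omega>)\<^sup>2" for \<omega>
    proof -
      have "2 * \<bar>Z \<omega>\<bar> \<le> 1 + (Z \<omega>)\<^sup>2"
        using zero_le_power2[of "\<bar>Z \<omega>\<bar> - 1"] by (simp add: power2_diff)
      then have "l * (2 * \<bar>Z \<omega>\<bar>) \<le> l * (1 + (Z \<omega>)\<^sup>2)"
        using l by (intro mult_left_mono) auto
      then show ?thesis using L_keep[of \<omega>] by (simp add: power2_sum algebra_simps)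
    qed
    then have "expectation L \<le> expectation (\<lambda>\<omega>. (l\<^sup>2 + l) + (l + 1) * (Z \<omega>)\<^sup>2)"
      by (intro integral_mono iL int')
    then show ?thesis unfolding E' by (simp add: power2_eq_square algebra_simps)
  qed
  define r where "r = t\<^sup>2 / (t\<^sup>2 + 1)"
  have pos: "t\<^sup>2 + 1 > 0" by (smt (verit) zero_le_power2)
  have r: "r \<ge> 0" unfolding r_def by simp
  have l2: "l\<^sup>2 \<ge> 4" using power_mono[OF l, of 2] by simp
  have K1: "risk_factor l \<ge> (l + 1)\<^sup>2"
    unfolding risk_factor_def by (simp add: mult_le_cancel_left1)
  have K2: "risk_factor l \<ge> l\<^sup>2 + 2 + 1 / l\<^sup>2"
  proof -
    have "l\<^sup>2 + 2 + 1 / l\<^sup>2 = (l\<^sup>2 + 1) * (1 + 1 / l\<^sup>2)" using l by (simp add: field_simps)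
    also have "\<dots> \<le> (l + 1)\<^sup>2 * (1 + 1 / l\<^sup>2)"
      using l by (intro mult_right_mono) (auto simp: power2_sum)
    finally show ?thesis by (simp add: risk_factor_def)
  qed
  have e_nonneg: "4 * exp 1 * l * exp (- l\<^sup>2 / 2) \<ge> 0" using l by simp
  consider "\<bar>t\<bar> \<le> 1 / l" | "1 / l \<le> \<bar>t\<bar>" "\<bar>t\<bar> \<le> l" | "l \<le> \<bar>t\<bar>" by linarith
  then have "expectation L \<le> 4 * exp 1 * l * exp (- l\<^sup>2 / 2) + risk_factor l * r"
  proof cases
    case 1
    define u where "u = l - 1 / l"
    have "1 / l \<le> 1 / 2" using l by (simp add: field_simps)
    moreover have "1 / l \<ge> 0" using l by simp
    ultimately have u: "u \<ge> 3 / 2" "u \<le> l" using l unfolding u_def by linarith+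
    have u2: "u\<^sup>2 \<ge> 2" using power_mono[OF u(1), of 2] by (simp add: power2_eq_square)
    have eq: "u\<^sup>2 = l\<^sup>2 - 2 + 1 / l\<^sup>2"
      using l unfolding u_def by (simp add: power2_diff power_divide)
    have tail: "expectation (\<lambda>\<omega>. (Z \<omega>)\<^sup>2 * indicator {x. u \<le> \<bar>x\<bar>} (Z \<omega>)) \<le> 4 * u * std_normal_density u"
      using u by (intro std_normal_tail_second_moment[OF Z u2]) auto
    have it: "integrable M (\<lambda>\<omega>. (Z \<omega>)\<^sup>2 * indicator {x. u \<le> \<bar>x\<bar>} (Z \<omega>))"
      by (rule Bochner_Integration.integrable_bound[OF int]) (auto split: split_indicator)
    have "expectation L \<le> expectation (\<lambda>\<omega>. t\<^sup>2 + (Z \<omega>)\<^sup>2 * indicator {x. u \<le> \<bar>x\<bar>} (Z \<omega>))"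
    proof (rule integral_mono[OF iL])
      show "integrable M (\<lambda>\<omega>. t\<^sup>2 + (Z \<omega>)\<^sup>2 * indicator {x. u \<le> \<bar>x\<bar>} (Z \<omega>))" using it by simp
      fix \<omega>
      show "L \<omega> \<le> t\<^sup>2 + (Z \<omega>)\<^sup>2 * indicator {x. u \<le> \<bar>x\<bar>} (Z \<omega>)"
        using L_kill[of \<omega>] 1 unfolding u_def
        by (auto split: split_indicator split_indicator_asm intro: add_increasing2)
    qed
    also have "\<dots> = t\<^sup>2 + expectation (\<lambda>\<omega>. (Z \<omega>)\<^sup>2 * indicator {x. u \<le> \<bar>x\<bar>} (Z \<omega>))"
      using it by (simp add: prob_space)
    also have "\<dots> \<le> t\<^sup>2 + 4 * u * std_normal_density u" using tail by simp
    also have "\<dots> \<le> t\<^sup>2 + 4 * l * (exp 1 * exp (- l\<^sup>2 / 2))"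
    proof -
      have "std_normal_density u \<le> 1 * exp (- u\<^sup>2 / 2)"
        unfolding std_normal_density_def using pi_gt3 by (intro mult_right_mono) auto
      \<comment> \<open>The shift of the cutoff from \<open>l\<close> to \<open>l - 1 / l\<close> is paid for by the factor \<open>exp 1\<close> here.\<close>
      also have "\<dots> \<le> exp (1 + - l\<^sup>2 / 2)" using eq by simp
      finally have "std_normal_density u \<le> exp 1 * exp (- l\<^sup>2 / 2)" unfolding exp_add .
      then show ?thesis using u by (intro add_left_mono mult_mono) auto
    qed
    finally have bound: "expectation L \<le> 4 * exp 1 * l * exp (- l\<^sup>2 / 2) + t\<^sup>2" by (simp add: ac_simps)
    have "\<bar>t\<bar> \<le> 1" using 1 \<open>1 / l \<le> 1 / 2\<close> by linarith
    then have t1: "t\<^sup>2 \<le> 1" by (simp add: abs_square_le_1)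
    have "t\<^sup>2 = (t\<^sup>2 + 1) * r" using pos by (simp add: r_def)
    also have "\<dots> \<le> risk_factor l * r"
      using t1 K1 l l2 r by (intro mult_right_mono) (auto simp: power2_sum)
    finally show ?thesis using bound by linarith
  next
    case 2
    have "1 / l\<^sup>2 \<le> t\<^sup>2" using power_mono[OF 2(1), of 2] l by (simp add: power_divide)
    moreover have "t\<^sup>2 \<le> l\<^sup>2" using power_mono[OF 2(2), of 2] by simp
    \<comment> \<open>This product rewrites to \<open>t\<^sup>2 + 1 / t\<^sup>2 \<le> l\<^sup>2 + 1 / l\<^sup>2\<close>, multiplied by \<open>t\<^sup>2\<close>.\<close>
    ultimately have "(l\<^sup>2 - t\<^sup>2) * (t\<^sup>2 - 1 / l\<^sup>2) \<ge> 0" by simp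
    then have "(t\<^sup>2 + 1)\<^sup>2 \<le> (l\<^sup>2 + 2 + 1 / l\<^sup>2) * t\<^sup>2"
      using l by (simp add: algebra_simps power2_eq_square)
    also have "\<dots> \<le> risk_factor l * t\<^sup>2" using K2 by (intro mult_right_mono) auto
    finally have "t\<^sup>2 + 1 \<le> risk_factor l * r"
      using pos by (simp add: r_def field_simps power2_eq_square)
    then show ?thesis using E_mid e_nonneg by linarith
  next
    case 3
    have "l\<^sup>2 \<le> t\<^sup>2" using power_mono[OF 3, of 2] l by simp
    have "0 < l\<^sup>2" "0 < t\<^sup>2" using \<open>l\<^sup>2 \<le> t\<^sup>2\<close> l2 by linarith+
    have "1 = (1 + 1 / t\<^sup>2) * r"
    proof -
      have "1 + 1 / t\<^sup>2 = (t\<^sup>2 + 1) / t\<^sup>2" using \<open>0 < t\<^sup>2\<close> by (simp add: add_divide_distrib)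
      then show ?thesis using \<open>0 < t\<^sup>2\<close> pos unfolding r_def by simp
    qed
    also have "\<dots> \<le> (1 + 1 / l\<^sup>2) * r"
      using \<open>0 < l\<^sup>2\<close> \<open>l\<^sup>2 \<le> t\<^sup>2\<close> r by (intro mult_right_mono add_left_mono frac_le) auto
    finally have "1 \<le> (1 + 1 / l\<^sup>2) * r" .
    then have "(l + 1)\<^sup>2 * 1 \<le> (l + 1)\<^sup>2 * ((1 + 1 / l\<^sup>2) * r)" by (intro mult_left_mono) auto
    then show ?thesis using E_large e_nonneg unfolding risk_factor_def mult.assoc by linarith
  qed
  then show "expectation L \<le> 4 * exp 1 * l * exp (- l\<^sup>2 / 2) + risk_factor l * (t\<^sup>2 / (t\<^sup>2 + 1))"
    by (simp add: r_def)
qed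


section \<open>Coordinates with respect to an orthogonal system\<close>

locale orthogonal_system =
  fixes n p :: nat and \<psi> :: "nat \<Rightarrow> nat \<Rightarrow> real"
  assumes n_pos: "n \<ge> 1"
    and dot_psi: "\<And>j k. j \<in> {1..p} \<Longrightarrow> k \<in> {1..p} \<Longrightarrow>
      dot n (\<psi> j) (\<psi> k) = (if j = k then real n else 0)"
begin

lemma dot_lin_comb: "dot n x (lin_comb I c \<psi>) = (\<Sum>j\<in>I. c j * dot n x (\<psi> j))"
proof -
  have "dot n x (lin_comb I c \<psi>) = (\<Sum>i\<in>{1..n}. \<Sum>j\<in>I. c j * (x i * \<psi> j i))"
    by (simp add: dot_def lin_comb_def sum_distrib_left ac_simps)
  also have "\<dots> = (\<Sum>j\<in>I. c j * dot n x (\<psi> j))"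
    by (subst sum.swap) (simp add: dot_def sum_distrib_left)
  finally show ?thesis .
qed

lemma coef_est_lin_comb:
  assumes "I \<subseteq> {1..p}" "j \<in> I"
  shows "coef_est n \<psi> (lin_comb I c \<psi>) j = c j"
proof -
  have fin: "finite I" using assms(1) finite_subset by blast
  have "dot n (\<psi> j) (lin_comb I c \<psi>) = (\<Sum>k\<in>I. if k = j then c k * real n else 0)"
    unfolding dot_lin_comb using assms by (intro sum.cong) (auto simp: dot_psi subset_iff)
  also have "\<dots> = c j * real n" using assms fin by simp
  finally show ?thesis using n_pos by (simp add: coef_est_def)
qed

lemma coef_est_add:
  "coef_est n \<psi> (\<lambda>i. x i + y i) j = coef_est n \<psi> x j + coef_est n \<psi> y j"
  by (simp add: coef_est_def dot_def distrib_left sum.distrib add_divide_distrib)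

lemma parseval:
  "(1 / real n) * (L2_set (\<lambda>i. lin_comb {1..p} c \<psi> i - lin_comb {1..p} d \<psi> i) {1..n})\<^sup>2
     = (\<Sum>j\<in>{1..p}. (c j - d j)\<^sup>2)"
proof -
  define a where "a j = c j - d j" for j
  have diff: "lin_comb {1..p} c \<psi> i - lin_comb {1..p} d \<psi> i = lin_comb {1..p} a \<psi> i" for i
    by (simp add: lin_comb_def a_def left_diff_distrib sum_subtractf)
  let ?v = "lin_comb {1..p} a \<psi>"
  have "(L2_set (\<lambda>i. lin_comb {1..p} c \<psi> i - lin_comb {1..p} d \<psi> i) {1..n})\<^sup>2 = dot n ?v ?v"
    unfolding diff L2_set_def dot_def by (simp add: sum_nonneg power2_eq_square)
  also have "\<dots> = (\<Sum>j\<in>{1..p}. a j * dot n ?v (\<psi> j))" by (rule dot_lin_comb)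
  also have "\<dots> = (\<Sum>j\<in>{1..p}. a j * (real n * a j))"
  proof (rule sum.cong[OF refl])
    fix j assume "j \<in> {1..p}"
    then have "coef_est n \<psi> ?v j = a j" by (intro coef_est_lin_comb) auto
    moreover have "dot n ?v (\<psi> j) = dot n (\<psi> j) ?v" by (simp add: dot_def mult.commute)
    ultimately show "a j * dot n ?v (\<psi> j) = a j * (real n * a j)"
      using n_pos by (simp add: coef_est_def field_simps)
  qed
  also have "\<dots> = real n * (\<Sum>j\<in>{1..p}. (a j)\<^sup>2)"
    by (simp add: sum_distrib_left power2_eq_square ac_simps)
  finally show ?thesis using n_pos by (simp add: a_def)
qed

text \<open>
  Testing the orthogonality condition against a single \<open>\<psi> j\<close> determines the \<open>j\<close>-th coefficient;
  this is what makes the description of the projection unique.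
\<close>

lemma orth_proj_eq:
  assumes I: "I \<subseteq> {1..p}"
  shows "orth_proj n \<psi> I y = lin_comb I (coef_est n \<psi> y) \<psi>"
  unfolding orth_proj_def
proof (rule the_equality)
  have fin: "finite I" using I finite_subset by blast
  have dot_diff: "dot n (\<lambda>i. y i - v i) (lin_comb I c \<psi>)
      = (\<Sum>j\<in>I. c j * (real n * (coef_est n \<psi> y j - coef_est n \<psi> v j)))" for v c
  proof -
    have "dot n (\<lambda>i. y i - v i) (\<psi> j) = real n * (coef_est n \<psi> y j - coef_est n \<psi> v j)" for j
    proof -
      have "dot n (\<lambda>i. y i - v i) (\<psi> j) = dot n (\<psi> j) y - dot n (\<psi> j) v"
        by (simp add: dot_def algebra_simps sum_subtractf)
      then show ?thesis using n_pos by (simp add: coef_est_def diff_divide_distrib[symmetric])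
    qed
    then show ?thesis unfolding dot_lin_comb by simp
  qed
  let ?P = "lin_comb I (coef_est n \<psi> y) \<psi>"
  show "?P \<in> lin_span I \<psi> \<and> (\<forall>u\<in>lin_span I \<psi>. dot n (\<lambda>i. y i - ?P i) u = 0)"
    unfolding lin_span_def by (auto simp: dot_diff coef_est_lin_comb[OF I])
  fix v
  assume v: "v \<in> lin_span I \<psi> \<and> (\<forall>u\<in>lin_span I \<psi>. dot n (\<lambda>i. y i - v i) u = 0)"
  then obtain c where c: "v = lin_comb I c \<psi>" by (auto simp: lin_span_def)
  have "c j = coef_est n \<psi> y j" if j: "j \<in> I" for j
  proof -
    have "dot n (\<lambda>i. y i - v i) (lin_comb I (\<lambda>k. if k = j then 1 else 0) \<psi>) = 0"
      using v by (auto simp: lin_span_def)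
    then show ?thesis
      using n_pos j fin unfolding dot_diff c
      by (simp add: coef_est_lin_comb[OF I] if_distrib[of "\<lambda>x. x * _"] cong: if_cong)
  qed
  then show "v = ?P" unfolding c lin_comb_def by simp
qed

text \<open>
  Since the system is orthogonal, a vector \<open>\<psi> j\<close> keeps its coefficient in every projection onto a
  set containing \<open>j\<close>. Only the total weight of these sets matters for the average.
\<close>

definition shrinkage :: "(nat set \<Rightarrow> real) \<Rightarrow> nat \<Rightarrow> real" where
  "shrinkage w j = (\<Sum>I\<in>Pow {1..p}. if j \<in> I then w I else 0)"

lemma ma_estimator_eq_shrinkage:
  "ma_estimator n p \<psi> w y = lin_comb {1..p} (\<lambda>j. shrinkage w j * coef_est n \<psi> y j) \<psi>"
proof
  fix i
  have "ma_estimator n p \<psi> w y i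
      = (\<Sum>I\<in>Pow {1..p}. \<Sum>j\<in>{1..p}. (if j \<in> I then w I else 0) * (coef_est n \<psi> y j * \<psi> j i))"
    unfolding ma_estimator_def
  proof (rule sum.cong[OF refl])
    fix I assume "I \<in> Pow {1..p}"
    then have I: "I \<subseteq> {1..p}" by simp
    have "w I * orth_proj n \<psi> I y i = (\<Sum>j\<in>I. w I * (coef_est n \<psi> y j * \<psi> j i))"
      by (simp add: orth_proj_eq[OF I] lin_comb_def sum_distrib_left)
    also have "\<dots> = (\<Sum>j\<in>{1..p}. (if j \<in> I then w I else 0) * (coef_est n \<psi> y j * \<psi> j i))"
      using I by (intro sum.mono_neutral_cong_left) auto
    finally show "w I * orth_proj n \<psi> I y i
        = (\<Sum>j\<in>{1..p}. (if j \<in> I then w I else 0) * (coef_est n \<psi> y j * \<psi> j i))" .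
  qed
  also have "\<dots> = (\<Sum>j\<in>{1..p}. shrinkage w j * coef_est n \<psi> y j * \<psi> j i)"
    by (subst sum.swap) (simp add: shrinkage_def sum_distrib_right mult.assoc)
  finally show "ma_estimator n p \<psi> w y i
      = lin_comb {1..p} (\<lambda>j. shrinkage w j * coef_est n \<psi> y j) \<psi> i"
    by (simp add: lin_comb_def)
qed

end

section \<open>Risks in the Gaussian sequence model\<close>

lemma weights_nonempty: "weights p \<noteq> {}"
proof -
  have "(\<lambda>I. if I = {} then 1 else 0) \<in> weights p"
    by (simp add: weights_def)
  then show ?thesis by blast
qed

text \<open>
  The right-hand side is the mean squared error of \<open>g * (t + Z)\<close> for a standardized error \<open>Z\<close>,
  minimized by \<open>g = t\<^sup>2 / (t\<^sup>2 + 1)\<close>; completing the square at this \<open>g\<close> gives the bound.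
\<close>

lemma shrinkage_risk_lower_bound:
  fixes g t :: real
  shows "t\<^sup>2 / (t\<^sup>2 + 1) \<le> (1 - g)\<^sup>2 * t\<^sup>2 + g\<^sup>2"
proof -
  have pos: "t\<^sup>2 + 1 > 0" by (smt (verit) zero_le_power2)
  have "((1 - g)\<^sup>2 * t\<^sup>2 + g\<^sup>2) * (t\<^sup>2 + 1) - t\<^sup>2 = ((1 - g) * t\<^sup>2 - g)\<^sup>2"
    by (simp add: power2_eq_square algebra_simps)
  then have "t\<^sup>2 \<le> ((1 - g)\<^sup>2 * t\<^sup>2 + g\<^sup>2) * (t\<^sup>2 + 1)"
    by (smt (verit) zero_le_power2)
  then show ?thesis using pos by (simp add: divide_le_eq)
qed

locale gaussian_sequence_model = orthogonal_system n p \<psi> + prob_space M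
  for n p \<psi> and M :: "'a measure" +
  fixes \<epsilon> :: "nat \<Rightarrow> 'a \<Rightarrow> real" and s :: real
  assumes s_pos: "s > 0"
    and noise: "\<And>j. j \<in> {1..p} \<Longrightarrow>
      distributed M lborel (\<lambda>\<omega>. coef_est n \<psi> (\<lambda>i. \<epsilon> i \<omega>) j) (normal_density 0 s)"
begin

definition Z :: "nat \<Rightarrow> 'a \<Rightarrow> real" where
  "Z j \<omega> = coef_est n \<psi> (\<lambda>i. \<epsilon> i \<omega>) j / s"

lemma Z_std_normal: "j \<in> {1..p} \<Longrightarrow> distributed M lborel (Z j) std_normal_density"
  using noise[of j] normal_standard_normal_convert[OF s_pos, of _ 0] by (simp add: Z_def[abs_def])

lemma risk_diagonal:
  "risk n M \<epsilon> (\<lambda>y. lin_comb {1..p} (\<lambda>j. h j (coef_est n \<psi> y j)) \<psi>) (lin_comb {1..p} \<theta> \<psi>)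
     = (\<integral>\<omega>. (\<Sum>j\<in>{1..p}. (h j (\<theta> j + s * Z j \<omega>) - \<theta> j)\<^sup>2) \<partial>M)"
proof -
  have obs: "coef_est n \<psi> (\<lambda>k. lin_comb {1..p} \<theta> \<psi> k + \<epsilon> k \<omega>) j = \<theta> j + s * Z j \<omega>"
    if "j \<in> {1..p}" for j \<omega>
    using that s_pos by (simp add: coef_est_add coef_est_lin_comb Z_def)
  show ?thesis
    unfolding risk_def integral_mult_right_zero[symmetric] parseval
    by (intro Bochner_Integration.integral_cong sum.cong refl) (simp only: obs)
qed

lemma risk_threshold_le:
  assumes l: "l \<ge> 2" and \<eta>: "threshold_rule (l * s) \<eta>"
  shows "risk n M \<epsilon> (\<lambda>y. lin_comb {1..p} (\<lambda>j. \<eta> (coef_est n \<psi> y j)) \<psi>) (lin_comb {1..p} \<theta> \<psi>)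
    \<le> s\<^sup>2 * (real p * (4 * exp 1 * l * exp (- l\<^sup>2 / 2))
        + risk_factor l * (\<Sum>j\<in>{1..p}. (\<theta> j / s)\<^sup>2 / ((\<theta> j / s)\<^sup>2 + 1)))"
proof -
  define e where "e = 4 * exp 1 * l * exp (- l\<^sup>2 / 2)"
  define L where "L j \<omega> = ((\<eta> (\<theta> j + s * Z j \<omega>) - \<theta> j) / s)\<^sup>2" for j \<omega>
  have [measurable]: "\<eta> \<in> borel_measurable borel" using \<eta> by (simp add: threshold_rule_def)
  have L: "integrable M (L j)"
      "expectation (L j) \<le> e + risk_factor l * ((\<theta> j / s)\<^sup>2 / ((\<theta> j / s)\<^sup>2 + 1))"
    if j: "j \<in> {1..p}" for j
  proof -
    have [measurable]: "Z j \<in> borel_measurable M"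
      using distributed_measurable[OF Z_std_normal[OF j]] by simp
    have meas: "L j \<in> borel_measurable M" unfolding L_def[abs_def] by measurable
    have nonneg: "0 \<le> L j \<omega>" for \<omega> by (simp add: L_def)
    have kill: "L j \<omega> \<le> (\<theta> j / s)\<^sup>2 + (Z j \<omega>)\<^sup>2 * indicator {y. l < \<bar>y\<bar>} (\<theta> j / s + Z j \<omega>)" for \<omega>
    proof -
      let ?x = "\<theta> j + s * Z j \<omega>"
      have abs: "\<bar>?x\<bar> = s * \<bar>\<theta> j / s + Z j \<omega>\<bar>"
      proof -
        have "?x = s * (\<theta> j / s + Z j \<omega>)" using s_pos by (simp add: field_simps)
        then show ?thesis using s_pos by (simp add: abs_mult)
      qed
      have ind: "(l * s < \<bar>?x\<bar>) = (l < \<bar>\<theta> j / s + Z j \<omega>\<bar>)"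
        unfolding abs using s_pos by (simp add: mult.commute)
      have "(\<eta> ?x - \<theta> j)\<^sup>2 \<le> (\<theta> j)\<^sup>2 + (?x - \<theta> j)\<^sup>2 * indicator {y. l * s < \<bar>y\<bar>} ?x"
        using \<eta> unfolding threshold_rule_def by blast
      then have "(\<eta> ?x - \<theta> j)\<^sup>2 / s\<^sup>2 \<le> ((\<theta> j)\<^sup>2 + (?x - \<theta> j)\<^sup>2 * indicator {y. l * s < \<bar>y\<bar>} ?x) / s\<^sup>2"
        by (intro divide_right_mono) auto
      also have "\<dots> = (\<theta> j / s)\<^sup>2 + (Z j \<omega>)\<^sup>2 * indicator {y. l < \<bar>y\<bar>} (\<theta> j / s + Z j \<omega>)"
        using s_pos ind by (simp add: indicator_def power_divide power_mult_distrib add_divide_distrib)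
      finally show ?thesis by (simp add: L_def power_divide)
    qed
    have keep: "L j \<omega> \<le> (l + \<bar>Z j \<omega>\<bar>)\<^sup>2" for \<omega>
    proof -
      let ?x = "\<theta> j + s * Z j \<omega>"
      have "\<bar>\<eta> ?x - \<theta> j\<bar> \<le> l * s + \<bar>?x - \<theta> j\<bar>"
        using \<eta> unfolding threshold_rule_def by blast
      also have "\<dots> = s * (l + \<bar>Z j \<omega>\<bar>)" using s_pos by (simp add: abs_mult algebra_simps)
      finally have "\<bar>(\<eta> ?x - \<theta> j) / s\<bar> \<le> l + \<bar>Z j \<omega>\<bar>"
        using s_pos by (simp add: abs_divide divide_le_eq mult.commute)
      then have "\<bar>(\<eta> ?x - \<theta> j) / s\<bar>\<^sup>2 \<le> (l + \<bar>Z j \<omega>\<bar>)\<^sup>2" by (intro power_mono) auto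
      then show ?thesis unfolding L_def power2_abs .
    qed
    show "integrable M (L j)"
      by (rule threshold_loss_unit_noise(1)[OF Z_std_normal[OF j] l meas nonneg kill keep])
    show "expectation (L j) \<le> e + risk_factor l * ((\<theta> j / s)\<^sup>2 / ((\<theta> j / s)\<^sup>2 + 1))"
      unfolding e_def
      by (rule threshold_loss_unit_noise(2)[OF Z_std_normal[OF j] l meas nonneg kill keep])
  qed
  have "risk n M \<epsilon> (\<lambda>y. lin_comb {1..p} (\<lambda>j. \<eta> (coef_est n \<psi> y j)) \<psi>) (lin_comb {1..p} \<theta> \<psi>)
      = (\<integral>\<omega>. s\<^sup>2 * (\<Sum>j\<in>{1..p}. L j \<omega>) \<partial>M)"
    unfolding L_def using s_pos risk_diagonal[of "\<lambda>_. \<eta>" \<theta>]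
    by (simp add: power_divide sum_divide_distrib[symmetric])
  also have "\<dots> = s\<^sup>2 * (\<Sum>j\<in>{1..p}. expectation (L j))"
    using L(1) by simp
  also have "\<dots> \<le> s\<^sup>2 * (\<Sum>j\<in>{1..p}. e + risk_factor l * ((\<theta> j / s)\<^sup>2 / ((\<theta> j / s)\<^sup>2 + 1)))"
    using L(2) by (intro mult_left_mono sum_mono) auto
  also have "\<dots> = s\<^sup>2 * (real p * e + risk_factor l * (\<Sum>j\<in>{1..p}. (\<theta> j / s)\<^sup>2 / ((\<theta> j / s)\<^sup>2 + 1)))"
    by (simp add: sum.distrib sum_distrib_left)
  finally show ?thesis unfolding e_def .
qed

lemma optimal_ma_risk_ge:
  "s\<^sup>2 * (\<Sum>j\<in>{1..p}. (\<theta> j / s)\<^sup>2 / ((\<theta> j / s)\<^sup>2 + 1))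
     \<le> optimal_ma_risk n p \<psi> M \<epsilon> (lin_comb {1..p} \<theta> \<psi>)"
  unfolding optimal_ma_risk_def
proof (rule cINF_greatest[OF weights_nonempty])
  fix w
  define g where "g = shrinkage w"
  have sq: "(g j * (\<theta> j + s * Z j \<omega>) - \<theta> j)\<^sup>2
      = (1 - g j)\<^sup>2 * (\<theta> j)\<^sup>2 + (2 * (g j - 1) * g j * \<theta> j * s) * Z j \<omega> + ((g j)\<^sup>2 * s\<^sup>2) * (Z j \<omega>)\<^sup>2" for j \<omega>
    by (simp add: power2_eq_square algebra_simps)
  have "risk n M \<epsilon> (ma_estimator n p \<psi> w) (lin_comb {1..p} \<theta> \<psi>)
      = (\<integral>\<omega>. (\<Sum>j\<in>{1..p}. (g j * (\<theta> j + s * Z j \<omega>) - \<theta> j)\<^sup>2) \<partial>M)"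
    using risk_diagonal[of "\<lambda>j x. g j * x" \<theta>] by (simp add: ma_estimator_eq_shrinkage[abs_def] g_def)
  also have "\<dots> = (\<Sum>j\<in>{1..p}. (1 - g j)\<^sup>2 * (\<theta> j)\<^sup>2 + (g j)\<^sup>2 * s\<^sup>2)"
    unfolding sq using std_normal_moments[OF Z_std_normal] by (simp add: prob_space)
  also have "\<dots> = s\<^sup>2 * (\<Sum>j\<in>{1..p}. (1 - g j)\<^sup>2 * (\<theta> j / s)\<^sup>2 + (g j)\<^sup>2)"
    using s_pos by (simp add: sum_distrib_left power_divide algebra_simps)
  also have "\<dots> \<ge> s\<^sup>2 * (\<Sum>j\<in>{1..p}. (\<theta> j / s)\<^sup>2 / ((\<theta> j / s)\<^sup>2 + 1))"
    by (intro mult_left_mono sum_mono shrinkage_risk_lower_bound) auto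
  finally show "s\<^sup>2 * (\<Sum>j\<in>{1..p}. (\<theta> j / s)\<^sup>2 / ((\<theta> j / s)\<^sup>2 + 1))
      \<le> risk n M \<epsilon> (ma_estimator n p \<psi> w) (lin_comb {1..p} \<theta> \<psi>)" .
qed

end

section \<open>The ratio of the risks\<close>

text \<open>
  The first summand compares the coordinatewise risks with the optimal averaging risk. The second
  one charges the \<open>p\<close> Gaussian tail terms, of total size \<open>4 * exp 1 * l * s\<^sup>2\<close> if
  \<open>p * exp (- l\<^sup>2 / 2) = 1\<close>, to \<open>1 / n = s\<^sup>2 / \<sigma>\<^sup>2\<close>.
\<close>

definition ratio_bound :: "real \<Rightarrow> real \<Rightarrow> real" where
  "ratio_bound \<sigma> l = risk_factor l + 4 * exp 1 * \<sigma>\<^sup>2 * l"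

lemma ratio_bound_asymp: "((\<lambda>l. ratio_bound \<sigma> l / l\<^sup>2 - 1) \<longlongrightarrow> 0) at_top"
  unfolding ratio_bound_def risk_factor_def by real_asymp

lemma (in gaussian_sequence_model) threshold_risk_ratio_le:
  assumes \<sigma>: "\<sigma> > 0" and s: "s\<^sup>2 = \<sigma>\<^sup>2 / real n" and p: "p \<ge> 1"
    and l: "l = sqrt (2 * ln (real p))" "l \<ge> 2" and \<eta>: "threshold_rule (l * s) \<eta>"
    and \<mu>: "\<mu> \<in> lin_span {1..p} \<psi>"
  shows "risk n M \<epsilon> (\<lambda>y. lin_comb {1..p} (\<lambda>j. \<eta> (coef_est n \<psi> y j)) \<psi>) \<mu>
      / (1 / real n + optimal_ma_risk n p \<psi> M \<epsilon> \<mu>) \<le> ratio_bound \<sigma> l"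
proof -
  obtain \<theta> where \<mu>_eq: "\<mu> = lin_comb {1..p} \<theta> \<psi>" using \<mu> by (auto simp: lin_span_def)
  define R where "R = (\<Sum>j\<in>{1..p}. (\<theta> j / s)\<^sup>2 / ((\<theta> j / s)\<^sup>2 + 1))"
  have R: "R \<ge> 0" unfolding R_def by (intro sum_nonneg) auto
  have opt: "s\<^sup>2 * R \<le> optimal_ma_risk n p \<psi> M \<epsilon> \<mu>"
    unfolding R_def \<mu>_eq by (rule optimal_ma_risk_ge)
  have nn: "1 / real n = s\<^sup>2 / \<sigma>\<^sup>2" using \<sigma> s by simp
  have npos: "1 / real n > 0" using n_pos by simp
  have B: "ratio_bound \<sigma> l \<ge> risk_factor l" "ratio_bound \<sigma> l \<ge> 4 * exp 1 * \<sigma>\<^sup>2 * l" "ratio_bound \<sigma> l \<ge> 0"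
  proof -
    have "risk_factor l \<ge> 0" "4 * exp 1 * \<sigma>\<^sup>2 * l \<ge> 0" using l(2) by (simp_all add: risk_factor_def)
    then show "ratio_bound \<sigma> l \<ge> risk_factor l" "ratio_bound \<sigma> l \<ge> 4 * exp 1 * \<sigma>\<^sup>2 * l"
      "ratio_bound \<sigma> l \<ge> 0" unfolding ratio_bound_def by linarith+
  qed
  have "ln (real p) \<ge> 0" using p by simp
  then have "- l\<^sup>2 / 2 = - ln (real p)" unfolding l(1) by simp
  then have pe: "real p * exp (- l\<^sup>2 / 2) = 1" using p by (simp add: exp_minus)
  have "risk n M \<epsilon> (\<lambda>y. lin_comb {1..p} (\<lambda>j. \<eta> (coef_est n \<psi> y j)) \<psi>) \<mu>
      \<le> s\<^sup>2 * (real p * (4 * exp 1 * l * exp (- l\<^sup>2 / 2)) + risk_factor l * R)"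
    unfolding R_def \<mu>_eq by (rule risk_threshold_le[OF l(2) \<eta>])
  also have "real p * (4 * exp 1 * l * exp (- l\<^sup>2 / 2)) = 4 * exp 1 * l * (real p * exp (- l\<^sup>2 / 2))"
    by (simp add: ac_simps)
  also have "s\<^sup>2 * (4 * exp 1 * l * (real p * exp (- l\<^sup>2 / 2)) + risk_factor l * R)
      = (4 * exp 1 * \<sigma>\<^sup>2 * l) * (s\<^sup>2 / \<sigma>\<^sup>2) + risk_factor l * (s\<^sup>2 * R)"
    unfolding pe using \<sigma> by (simp add: field_simps)
  also have "\<dots> \<le> ratio_bound \<sigma> l * (1 / real n) + ratio_bound \<sigma> l * (s\<^sup>2 * R)"
    unfolding nn using B R by (intro add_mono mult_right_mono) auto
  also have "\<dots> \<le> ratio_bound \<sigma> l * (1 / real n + optimal_ma_risk n p \<psi> M \<epsilon> \<mu>)"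
    using opt B(3) unfolding distrib_left by (intro add_left_mono mult_left_mono)
  finally have le: "risk n M \<epsilon> (\<lambda>y. lin_comb {1..p} (\<lambda>j. \<eta> (coef_est n \<psi> y j)) \<psi>) \<mu>
      \<le> ratio_bound \<sigma> l * (1 / real n + optimal_ma_risk n p \<psi> M \<epsilon> \<mu>)" .
  have "s\<^sup>2 * R \<ge> 0" using R by simp
  then have "1 / real n + optimal_ma_risk n p \<psi> M \<epsilon> \<mu> > 0" using opt npos by linarith
  then show ?thesis using le by (simp add: pos_divide_le_eq)
qed

theorem corollary3:
  fixes \<sigma> :: real
    and p :: "nat \<Rightarrow> nat"
    and \<psi> :: "nat \<Rightarrow> nat \<Rightarrow> nat \<Rightarrow> real"
    and M :: "nat \<Rightarrow> 'a measure"
    and \<epsilon> :: "nat \<Rightarrow> nat \<Rightarrow> 'a \<Rightarrow> real"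
    and T :: "real \<Rightarrow> nat \<Rightarrow> nat \<Rightarrow> (nat \<Rightarrow> nat \<Rightarrow> real) \<Rightarrow> (nat \<Rightarrow> real) \<Rightarrow> nat \<Rightarrow> real"
  assumes sigma_pos: "\<sigma> > 0"
    and p_range: "\<And>n. n \<ge> 1 \<Longrightarrow> 1 \<le> p n \<and> p n \<le> n"
    and psi_norm: "\<And>n j. n \<ge> 1 \<Longrightarrow> j \<in> {1..p n} \<Longrightarrow>
           (1 / real n) * (L2_set (\<psi> n j) {1..n})\<^sup>2 = 1"
    and psi_orth: "\<And>n j j'. n \<ge> 1 \<Longrightarrow> j \<in> {1..p n} \<Longrightarrow> j' \<in> {1..p n} \<Longrightarrow> j \<noteq> j' \<Longrightarrow>
           dot n (\<psi> n j) (\<psi> n j') = 0"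
    and prob: "\<And>n. n \<ge> 1 \<Longrightarrow> prob_space (M n)"
    and indep: "\<And>n. n \<ge> 1 \<Longrightarrow> prob_space.indep_vars (M n) (\<lambda>_. borel) (\<epsilon> n) {1..n}"
    and eps_integrable: "\<And>n i. n \<ge> 1 \<Longrightarrow> i \<in> {1..n} \<Longrightarrow>
           integrable (M n) (\<epsilon> n i) \<and> integrable (M n) (\<lambda>\<omega>. (\<epsilon> n i \<omega>)\<^sup>2)"
    and eps_mean: "\<And>n i. n \<ge> 1 \<Longrightarrow> i \<in> {1..n} \<Longrightarrow> prob_space.expectation (M n) (\<epsilon> n i) = 0"
    and eps_var: "\<And>n i. n \<ge> 1 \<Longrightarrow> i \<in> {1..n} \<Longrightarrow> prob_space.variance (M n) (\<epsilon> n i) = \<sigma>\<^sup>2"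
    and gaussian: "\<And>n j. n \<ge> 1 \<Longrightarrow> j \<in> {1..p n} \<Longrightarrow>
           distributed (M n) lborel (\<lambda>\<omega>. (1 / real n) * dot n (\<psi> n j) (\<lambda>i. \<epsilon> n i \<omega>))
             (normal_density 0 (sqrt (\<sigma>\<^sup>2 / real n)))"
    and T_choice: "T = soft_threshold \<or> T = hard_threshold"
    and p_lim: "filterlim p at_top sequentially"
  shows "\<exists>\<delta> :: nat \<Rightarrow> real. \<delta> \<longlonglongrightarrow> 0 \<and>
           (\<forall>\<^sub>F n in sequentially.
              (SUP \<mu>\<in>lin_span {1..p n} (\<psi> n).
                 ereal (risk n (M n) (\<epsilon> n) (T \<sigma> n (p n) (\<psi> n)) \<mu> /
                        (1 / real n + optimal_ma_risk n (p n) (\<psi> n) (M n) (\<epsilon> n) \<mu>)))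
              \<le> ereal ((1 + \<delta> n) * (2 * ln (real (p n)))))"
proof -
  define l where "l n = sqrt (2 * ln (real (p n)))" for n
  define \<delta> where "\<delta> n = ratio_bound \<sigma> (l n) / (l n)\<^sup>2 - 1" for n
  have "filterlim (\<lambda>x. sqrt (2 * ln (real x))) at_top sequentially" by real_asymp
  then have l_lim: "filterlim l at_top sequentially"
    unfolding l_def[abs_def] by (rule filterlim_compose[OF _ p_lim])
  have "\<delta> \<longlonglongrightarrow> 0"
    unfolding \<delta>_def[abs_def] by (rule filterlim_compose[OF ratio_bound_asymp l_lim])
  moreover have "\<forall>\<^sub>F n in sequentially.
      (SUP \<mu>\<in>lin_span {1..p n} (\<psi> n).
         ereal (risk n (M n) (\<epsilon> n) (T \<sigma> n (p n) (\<psi> n)) \<mu> /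
                (1 / real n + optimal_ma_risk n (p n) (\<psi> n) (M n) (\<epsilon> n) \<mu>)))
      \<le> ereal ((1 + \<delta> n) * (2 * ln (real (p n))))"
    using eventually_ge_at_top[of 1] filterlim_at_top[THEN iffD1, OF l_lim, rule_format, of 2]
  proof eventually_elim
    case (elim n)
    note n = elim(1) and l2 = elim(2)
    define s where "s = \<sigma> / sqrt (real n)"
    have s: "s\<^sup>2 = \<sigma>\<^sup>2 / real n" "s > 0" using sigma_pos n by (auto simp: s_def power_divide)
    have sd: "sqrt (\<sigma>\<^sup>2 / real n) = s" using s by (metis less_imp_le real_sqrt_unique)
    have coef: "(1 / real n) * dot n (\<psi> n j) x = coef_est n (\<psi> n) x j" for j x
      by (simp add: coef_est_def)
    interpret prob_space "M n" by (rule prob[OF n])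
    interpret gaussian_sequence_model n "p n" "\<psi> n" "M n" "\<epsilon> n" s
    proof
      fix j assume j: "j \<in> {1..p n}"
      show "distributed (M n) lborel (\<lambda>\<omega>. coef_est n (\<psi> n) (\<lambda>i. \<epsilon> n i \<omega>) j) (normal_density 0 s)"
        using gaussian[OF n j] unfolding coef sd .
      fix k assume k: "k \<in> {1..p n}"
      have "dot n (\<psi> n j) (\<psi> n j) = real n"
        using psi_norm[OF n j] n
        by (simp add: L2_set_def dot_def sum_nonneg power2_eq_square field_simps)
      then show "dot n (\<psi> n j) (\<psi> n k) = (if j = k then real n else 0)"
        using psi_orth[OF n j k] by (cases "j = k") auto
    qed (use n s in auto)
    have thr: "threshold n (p n) * \<sigma> = l n * s"
      by (simp add: threshold_def l_def s_def real_sqrt_divide)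
    have "l n * s \<ge> 0" using l2 s by simp
    note rules = threshold_rule_soft[OF this] threshold_rule_hard[OF this]
    obtain \<eta> where \<eta>: "threshold_rule (l n * s) \<eta>"
      and T: "T \<sigma> n (p n) (\<psi> n) = (\<lambda>y. lin_comb {1..p n} (\<lambda>j. \<eta> (coef_est n (\<psi> n) y j)) (\<psi> n))"
      using T_choice
    proof
      assume "T = soft_threshold"
      then show ?thesis by (intro that[OF rules(1)]) (simp add: soft_threshold_def[abs_def] thr)
    next
      assume "T = hard_threshold"
      then show ?thesis by (intro that[OF rules(2)]) (simp add: hard_threshold_def[abs_def] thr)
    qed
    have "(1 + \<delta> n) * (2 * ln (real (p n))) = ratio_bound \<sigma> (l n)"
    proof -
      have "ln (real (p n)) \<ge> 0" using p_range[OF n] by simp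
      then have "2 * ln (real (p n)) = (l n)\<^sup>2" by (simp add: l_def)
      then show ?thesis using l2 by (simp add: \<delta>_def)
    qed
    then show ?case
      unfolding T
      using threshold_risk_ratio_le[OF sigma_pos s(1) _ l_def l2 \<eta>] p_range[OF n]
      by (intro SUP_least) auto
  qed
  ultimately show ?thesis by blast
qed

end
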